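(* Let $\ell\ge 2$ be an integer and let $(V^{\sf small},V^{\sf large})$ be an $\alpha$-valuation of the complete bipartite graph $K_{a,b}$, with $|V^{\sf small}|=a$ and $|V^{\sf large}|=b$, such that every element of $V^{\sf small}$ is a multiple of $\ell$ and $V^{\sf large}$ is a union of runs $R_i=\{i\ell-\ell+1,i\ell-\ell+2,\dots,i\ell\}$. Let $W^{\sf small}=\{y/\ell: y\in V^{\sf small}\}$, and let $W^{\sf large}$ be the set obtained by replacing each run $R_i=\{i\ell-\ell+1,\dots,i\ell\}\subseteq V^{\sf large}$ by the single element $i$. Then $(W^{\sf small},W^{\sf large})$ is an $\alpha$-valuation of $K_{a,b/\ell}$.
   Context: An $\alpha$-valuation of $K_{a,b}$ is a one-to-one labelling of its vertices by elements of $\{0,1,\dots,ab\}$ such that the absolute differences of endpoint labels over all edges are exactly $\{1,\dots,ab\}$, and there is a value $x$ such that every edge joins a vertex with label $\le x$ to a vertex with label $>x$. Vertices are identified with their labels; $V^{\sf small}$ is the set of labels $\le x$ and $V^{\sf large}$ the set of labels $>x$; equivalently, every element of $V^{\sf large}$ exceeds every element of $V^{\sf small}$ and the differences $u-z$ ($u\in V^{\sf large}$, $z\in V^{\sf small}$) are exactly $1,\dots,ab$, each once. *)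

theory Defs
  imports Main
begin

definition K_verts :: "nat \<Rightarrow> nat \<Rightarrow> (nat + nat) set" where
  "K_verts a b = Inl ` {..<a} \<union> Inr ` {..<b}"

definition K_edges :: "nat \<Rightarrow> nat \<Rightarrow> (nat + nat) set set" where
  "K_edges a b = {{Inl i, Inr j} | i j. i < a \<and> j < b}"

definition alpha_labelling :: "nat \<Rightarrow> nat \<Rightarrow> (nat + nat \<Rightarrow> nat) \<Rightarrow> nat \<Rightarrow> bool" where
  "alpha_labelling a b f x \<longleftrightarrow>
     inj_on f (K_verts a b) \<and>
     f ` K_verts a b \<subseteq> {0..a * b} \<and>
     {\<bar>int (f u) - int (f v)\<bar> | u v. {u, v} \<in> K_edges a b} = {1..int (a * b)} \<and>
     (\<forall>e \<in> K_edges a b. \<exists>u v. e = {u, v} \<and> f u \<le> x \<and> x < f v)"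

(* Vertices are identified with their labels.  Which side of the bipartition carries the
   small labels is left open here; it has to be pinned down by the cardinalities of S and L. *)
definition alpha_valuation :: "nat \<Rightarrow> nat \<Rightarrow> nat set \<Rightarrow> nat set \<Rightarrow> bool" where
  "alpha_valuation a b S L \<longleftrightarrow>
     (\<exists>f x. alpha_labelling a b f x \<and>
        S = {y \<in> f ` K_verts a b. y \<le> x} \<and>
        L = {y \<in> f ` K_verts a b. x < y})"

(* Only meant for i \<ge> 1: truncated subtraction makes the set empty for i = 0 and l \<ge> 1. *)
definition run :: "nat \<Rightarrow> nat \<Rightarrow> nat set" where
  "run l i = {i * l - l + 1..i * l}"

end

theory Submission
  imports Defs
begin

text \<open>With the correct cardinalities, an \<open>\<alpha>\<close>-valuation is just a pair of finite sets separated by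
  a threshold whose cross differences fill \<open>{1..a * b}\<close>. In this form the theorem is a matter of
  scaling: as the small labels are multiples of \<open>l\<close>, a difference is a multiple of \<open>l\<close> exactly when
  its large endpoint is the last element \<open>i * l\<close> of a run, so dividing these differences
  by \<open>l\<close> gives \<open>{1..a * b div l}\<close>.\<close>

section \<open>Valuations as separated sets of labels\<close>

lemma K_edges_iff:
  "{u, v} \<in> K_edges a b \<longleftrightarrow>
     (\<exists>i<a. \<exists>j<b. u = Inl i \<and> v = Inr j \<or> u = Inr j \<and> v = Inl i)"
  unfolding K_edges_def by (auto simp: doubleton_eq_iff)

text \<open>Cardinalities are left out and the bound \<open>m\<close> is a free parameter, so that
  division by \<open>l\<close> can act on this notion directly. The threshold keeps the truncated
  subtraction exact.\<close>

definition separated_differences :: "nat \<Rightarrow> nat set \<Rightarrow> nat set \<Rightarrow> bool" where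
  "separated_differences m S L \<longleftrightarrow>
     S \<union> L \<subseteq> {0..m} \<and> (\<exists>x. (\<forall>s\<in>S. s \<le> x) \<and> (\<forall>u\<in>L. x < u)) \<and>
     {u - s | u s. u \<in> L \<and> s \<in> S} = {1..m}"

text \<open>Links the integer differences of \<open>alpha_labelling\<close> with the natural ones of
  \<open>separated_differences\<close>: the order makes truncation harmless, and taking images under
  the injective \<open>int\<close> loses nothing.\<close>

lemma int_differences_eq_iff:
  assumes "\<And>u s. u \<in> L \<Longrightarrow> s \<in> S \<Longrightarrow> s < u"
  shows "{int u - int s | u s. u \<in> L \<and> s \<in> S} = {1..int m} \<longleftrightarrow>
         {u - s | u s. u \<in> L \<and> s \<in> S} = {1..m}"
proof -
  have "int u - int s = int (u - s)" if "u \<in> L" "s \<in> S" for u s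
    using assms[OF that] by simp
  hence "{int u - int s | u s. u \<in> L \<and> s \<in> S} = int ` {u - s | u s. u \<in> L \<and> s \<in> S}"
    by (auto simp: image_def) (metis+)
  moreover have "{1..int m} = int ` {1..m}"
    by (simp add: image_int_atLeastAtMost)
  ultimately show ?thesis
    by (simp add: inj_image_eq_iff)
qed

text \<open>Every edge joins a small label to a large one, so the content is the converse: each
  small-large pair must come from an edge, although the definition does not tie smallness to a side
  of the bipartition.\<close>

lemma separated_differences_if_alpha_valuation:
  assumes "alpha_valuation a b S L" "card S = a" "card L = b"
  shows "separated_differences (a * b) S L"
proof -
  from assms(1) obtain f x where f: "alpha_labelling a b f x"
    and S: "S = {y \<in> f ` K_verts a b. y \<le> x}" and L: "L = {y \<in> f ` K_verts a b. x < y}"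
    unfolding alpha_valuation_def by blast
  have fin: "finite S" "finite L"
    unfolding S L K_verts_def by auto
  have edge: "f (Inl i) \<le> x \<and> x < f (Inr j) \<or> f (Inr j) \<le> x \<and> x < f (Inl i)"
    if "i < a" "j < b" for i j
  proof -
    have "{Inl i, Inr j} \<in> K_edges a b"
      using that by (auto simp: K_edges_iff)
    moreover have "\<forall>e \<in> K_edges a b. \<exists>u v. e = {u, v} \<and> f u \<le> x \<and> x < f v"
      using f by (simp add: alpha_labelling_def)
    ultimately obtain u v where "{Inl i, Inr j} = {u, v}" "f u \<le> x" "x < f v"
      by meson
    thus ?thesis by (auto simp: doubleton_eq_iff)
  qed
  have "{\<bar>int (f u) - int (f v)\<bar> | u v. {u, v} \<in> K_edges a b}
      = {int u - int s | u s. u \<in> L \<and> s \<in> S}" (is "?A = ?B")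
  proof (intro equalityI subsetI)
    fix d assume "d \<in> ?A"
    then obtain i j where ij: "i < a" "j < b"
      and d: "d = \<bar>int (f (Inl i)) - int (f (Inr j))\<bar>"
      unfolding K_edges_iff by (auto simp: abs_minus_commute)
    have mem: "f (Inl i) \<in> f ` K_verts a b" "f (Inr j) \<in> f ` K_verts a b"
      using ij unfolding K_verts_def by auto
    from edge[OF ij] show "d \<in> ?B"
    proof
      assume *: "f (Inl i) \<le> x \<and> x < f (Inr j)"
      hence "d = int (f (Inr j)) - int (f (Inl i))" using d by simp
      moreover have "f (Inr j) \<in> L" "f (Inl i) \<in> S" using * mem by (auto simp: S L)
      ultimately show ?thesis by blast
    next
      assume *: "f (Inr j) \<le> x \<and> x < f (Inl i)"
      hence "d = int (f (Inl i)) - int (f (Inr j))" using d by simp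
      moreover have "f (Inl i) \<in> L" "f (Inr j) \<in> S" using * mem by (auto simp: S L)
      ultimately show ?thesis by blast
    qed
  next
    fix d assume "d \<in> ?B"
    then obtain u s where us: "u \<in> L" "s \<in> S" and d: "d = int u - int s" by blast
    \<comment> \<open>The cardinalities enter here. With an empty side there are no edges, and the
      threshold could split the isolated vertices arbitrarily. Positivity excludes this and makes
      \<open>Inl 0\<close> and \<open>Inr 0\<close> available as common neighbours.\<close>
    have pos: "a > 0" "b > 0"
      using us fin assms by (auto simp: card_gt_0_iff)
    obtain p q where p: "p \<in> K_verts a b" "u = f p" "x < f p"
      and q: "q \<in> K_verts a b" "s = f q" "f q \<le> x"
      using us unfolding S L by blast
    have "{p, q} \<in> K_edges a b"
    \<comment> \<open>Two vertices on the same side have a common neighbour, so they are both small or both large.\<close>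
    proof (cases p; cases q)
      fix i i' assume "p = Inl i" "q = Inl i'"
      thus ?thesis using p q edge[of i 0] edge[of i' 0] pos by (auto simp: K_verts_def)
    next
      fix j j' assume "p = Inr j" "q = Inr j'"
      thus ?thesis using p q edge[of 0 j] edge[of 0 j'] pos by (auto simp: K_verts_def)
    qed (use p q in \<open>auto simp: K_verts_def K_edges_iff\<close>)
    moreover have "d = \<bar>int (f p) - int (f q)\<bar>" using d p q by simp
    ultimately show "d \<in> ?A" by blast
  qed
  hence "?B = {1..int (a * b)}"
    using f unfolding alpha_labelling_def by simp
  moreover have "s < u" if "u \<in> L" "s \<in> S" for u s
    using that by (auto simp: S L)
  ultimately have "{u - s | u s. u \<in> L \<and> s \<in> S} = {1..a * b}"
    using int_differences_eq_iff[of L S "a * b"] by blast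
  moreover have "S \<union> L \<subseteq> {0..a * b}"
    using f unfolding alpha_labelling_def S L by blast
  moreover have "(\<forall>s\<in>S. s \<le> x) \<and> (\<forall>u\<in>L. x < u)"
    by (simp add: S L)
  ultimately show ?thesis
    unfolding separated_differences_def by blast
qed

text \<open>The left vertices enumerate \<open>S\<close> and the right ones \<open>L\<close>; the
  threshold keeps the two enumerations disjoint, so the combined labelling is injective.\<close>

lemma alpha_valuation_if_separated_differences:
  assumes "separated_differences (a * b) S L" "finite S" "finite L" "card S = a" "card L = b"
  shows "alpha_valuation a b S L"
proof -
  obtain x where x: "\<forall>s\<in>S. s \<le> x" "\<forall>u\<in>L. x < u"
    and sub: "S \<union> L \<subseteq> {0..a * b}"
    and diff: "{u - s | u s. u \<in> L \<and> s \<in> S} = {1..a * b}"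
    using assms(1) unfolding separated_differences_def by blast
  obtain g where g: "bij_betw g {..<a} S"
    using ex_bij_betw_nat_finite[OF assms(2)] assms(4) by (auto simp: atLeast0LessThan)
  obtain h where h: "bij_betw h {..<b} L"
    using ex_bij_betw_nat_finite[OF assms(3)] assms(5) by (auto simp: atLeast0LessThan)
  have gS: "S = g ` {..<a}" and hL: "L = h ` {..<b}"
    using g h by (simp_all add: bij_betw_def)
  let ?f = "case_sum g h"
  have im: "?f ` K_verts a b = S \<union> L"
    unfolding K_verts_def gS hL by (auto simp: image_Un image_image)
  have ne: "g i \<noteq> h j" if "i < a" "j < b" for i j
  proof -
    have "g i \<in> S" "h j \<in> L" using that by (simp_all add: gS hL)
    thus ?thesis using x by fastforce
  qed
  have "inj_on ?f (K_verts a b)"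
    using g h ne unfolding bij_betw_def inj_on_def K_verts_def by (auto dest: sym)
  moreover have "{\<bar>int (?f u) - int (?f v)\<bar> | u v. {u, v} \<in> K_edges a b} = {1..int (a * b)}"
  proof -
    have lt: "s < u" if "u \<in> L" "s \<in> S" for u s
      using that x by fastforce
    have "{\<bar>int (?f u) - int (?f v)\<bar> | u v. {u, v} \<in> K_edges a b}
        = {\<bar>int u - int s\<bar> | u s. u \<in> L \<and> s \<in> S}" (is "?A = ?B")
    proof (intro equalityI subsetI)
      fix d assume "d \<in> ?A"
      then obtain i j where "i < a" "j < b" "d = \<bar>int (h j) - int (g i)\<bar>"
        unfolding K_edges_iff by (auto simp: abs_minus_commute)
      thus "d \<in> ?B" unfolding gS hL by blast
    next
      fix d assume "d \<in> ?B"
      then obtain i j where "i < a" "j < b" "d = \<bar>int (h j) - int (g i)\<bar>"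
        unfolding gS hL by blast
      hence "{Inr j, Inl i} \<in> K_edges a b" and "d = \<bar>int (?f (Inr j)) - int (?f (Inl i))\<bar>"
        by (auto simp: K_edges_iff)
      thus "d \<in> ?A" by blast
    qed
    also have "\<dots> = {int u - int s | u s. u \<in> L \<and> s \<in> S}"
    proof -
      have "\<bar>int u - int s\<bar> = int u - int s" if "u \<in> L" "s \<in> S" for u s
        using lt[OF that] by simp
      thus ?thesis by (intro Collect_cong) metis
    qed
    also have "\<dots> = {1..int (a * b)}"
      using int_differences_eq_iff[of L S "a * b"] lt diff by blast
    finally show ?thesis .
  qed
  moreover have "\<forall>e \<in> K_edges a b. \<exists>u v. e = {u, v} \<and> ?f u \<le> x \<and> x < ?f v"
  proof
    fix e assume "e \<in> K_edges a b"
    then obtain i j where "i < a" "j < b" "e = {Inl i, Inr j}"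
      unfolding K_edges_def by blast
    moreover from this have "?f (Inl i) \<le> x" "x < ?f (Inr j)"
      using x unfolding gS hL by auto
    ultimately show "\<exists>u v. e = {u, v} \<and> ?f u \<le> x \<and> x < ?f v" by blast
  qed
  ultimately have "alpha_labelling a b ?f x"
    using sub unfolding alpha_labelling_def im by blast
  moreover have "S = {y \<in> S \<union> L. y \<le> x}" "L = {y \<in> S \<union> L. x < y}"
    using x by (auto simp: not_le[symmetric])
  ultimately show ?thesis
    unfolding alpha_valuation_def by (metis im)
qed

section \<open>Runs as half-open intervals \<open>((i - 1) * l, i * l]\<close>\<close>

lemma mem_run_iff:
  assumes "i \<ge> 1"
  shows "u \<in> run l i \<longleftrightarrow> (i - 1) * l < u \<and> u \<le> i * l"
  using assms by (auto simp: run_def diff_mult_distrib)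

text \<open>A common element gives \<open>(i - 1) * l < j * l\<close> and the same with
  \<open>i\<close> and \<open>j\<close> exchanged; cancelling \<open>l\<close> leaves
  \<open>i \<le> j\<close> and \<open>j \<le> i\<close>.\<close>

lemma run_index_unique:
  assumes "i \<ge> 1" "j \<ge> 1" "u \<in> run l i" "u \<in> run l j"
  shows "i = j"
proof -
  have "(i - 1) * l < j * l" "(j - 1) * l < i * l"
    using assms by (meson less_le_trans mem_run_iff)+
  hence "i - 1 < j" "j - 1 < i" by simp_all
  thus ?thesis using assms(1,2) by linarith
qed

lemma last_mem_run:
  assumes "i \<ge> 1" "l \<ge> 1"
  shows "i * l \<in> run l i"
  using assms by (simp add: mem_run_iff)

lemma card_run:
  assumes "i \<ge> 1"
  shows "card (run l i) = l"
  using assms by (cases i) (auto simp: run_def)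

lemma multiple_mem_run:
  assumes "i \<ge> 1" "l * k \<in> run l i"
  shows "k = i"
proof -
  \<comment> \<open>Positivity of \<open>l\<close> is read off from the membership, since the
    interval is empty for \<open>l = 0\<close>.\<close>
  have "(i - 1) * l < k * l" "k * l \<le> i * l" and "l > 0"
    using assms by (auto simp: mem_run_iff mult.commute intro: Nat.gr0I)
  thus ?thesis using assms(1) by simp
qed

text \<open>The last element \<open>i * l\<close> lies in no other run and so already identifies its
  own. This recovers the index set from the containment that defines \<open>W_large\<close>.\<close>

lemma run_subset_UN_iff:
  assumes "I \<subseteq> {1..}" "l \<ge> 1" "i \<ge> 1"
  shows "run l i \<subseteq> (\<Union>j\<in>I. run l j) \<longleftrightarrow> i \<in> I"
proof
  assume "run l i \<subseteq> (\<Union>j\<in>I. run l j)"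
  then obtain j where "j \<in> I" "i * l \<in> run l j"
    using last_mem_run[OF assms(3,2)] by blast
  thus "i \<in> I"
    using run_index_unique[OF assms(3) _ last_mem_run[OF assms(3,2)]] assms(1) by fastforce
qed blast

lemma card_UN_run:
  assumes "I \<subseteq> {1..}" "finite I"
  shows "card (\<Union>i\<in>I. run l i) = l * card I"
proof -
  have "card (\<Union>i\<in>I. run l i) = (\<Sum>i\<in>I. card (run l i))"
  proof (rule card_UN_disjoint[OF assms(2)])
    show "\<forall>i\<in>I. \<forall>j\<in>I. i \<noteq> j \<longrightarrow> run l i \<inter> run l j = {}"
      using run_index_unique[of _ _ _ l] assms(1) by (meson atLeast_iff disjoint_iff subsetD)
  qed (simp add: run_def)
  also have "\<dots> = (\<Sum>i\<in>I. l)"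
    using assms(1) card_run by (intro sum.cong refl) auto
  finally show ?thesis by simp
qed

section \<open>Dividing by \<open>l\<close>\<close>

lemma separated_differences_contract:
  assumes l: "l \<ge> 1" and I: "I \<subseteq> {1..}"
    and sep: "separated_differences (l * m) ((*) l ` T) (\<Union>i\<in>I. run l i)"
  shows "separated_differences m T I"
proof -
  let ?L = "\<Union>i\<in>I. run l i"
  obtain x where x: "\<forall>s\<in>(*) l ` T. s \<le> x" "\<forall>u\<in>?L. x < u"
    using sep unfolding separated_differences_def by metis
  have xT: "l * t \<le> x" if "t \<in> T" for t using x(1) that by simp
  have xL: "x < u" if "u \<in> ?L" for u using x(2) that by (rule bspec)
  have sub: "(*) l ` T \<union> ?L \<subseteq> {0..l * m}"
    and diff: "{u - s | u s. u \<in> ?L \<and> s \<in> (*) l ` T} = {1..l * m}"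
    using sep unfolding separated_differences_def by metis+
  have last: "l * i \<in> ?L" if "i \<in> I" for i
    using that I l last_mem_run[of i l] by (auto simp: mult.commute)
  \<comment> \<open>The new threshold is \<open>x div l\<close>: it inherits
    \<open>t \<le> x div l\<close> from \<open>l * t \<le> x\<close>, and \<open>x div l < i\<close>
    from \<open>x < l * i\<close>.\<close>
  have "t \<le> x div l" if "t \<in> T" for t
    using xT[OF that] l by (simp add: less_eq_div_iff_mult_less_eq mult.commute)
  moreover have "x div l < i" if "i \<in> I" for i
    using xL[OF last[OF that]] l by (simp add: div_less_iff_less_mult mult.commute)
  moreover have "T \<union> I \<subseteq> {0..m}"
  proof
    fix t assume "t \<in> T \<union> I"
    hence "l * t \<in> {0..l * m}" using sub last by blast
    thus "t \<in> {0..m}" using l by simp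
  qed
  moreover have "{u - s | u s. u \<in> I \<and> s \<in> T} = {1..m}"
  proof (intro equalityI subsetI)
    fix d assume "d \<in> {u - s | u s. u \<in> I \<and> s \<in> T}"
    then obtain i t where it: "i \<in> I" "t \<in> T" "d = i - t" by blast
    \<comment> \<open>As \<open>l * i\<close> ends the run of \<open>i\<close> and
      \<open>l * t\<close> is a small label, \<open>l * d\<close> is one of the given differences;
      its bounds are then divided by \<open>l\<close>.\<close>
    hence "l * d = l * i - l * t" by (simp add: diff_mult_distrib2)
    hence "l * d \<in> {1..l * m}"
      using last[OF it(1)] it(2) diff by blast
    thus "d \<in> {1..m}" using l by auto
  next
    fix d assume d: "d \<in> {1..m}"
    hence "l * d \<in> {1..l * m}" using l by simp
    then obtain u t where u: "u \<in> ?L" and t: "t \<in> T" and ut: "l * d = u - l * t"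
      unfolding diff[symmetric] by blast
    \<comment> \<open>Since \<open>l * t \<le> x < u\<close>, the subtraction is not truncated and
      can be undone. Thus \<open>u\<close> is a multiple of \<open>l\<close>, which forces it to be
      the last element of its run.\<close>
    have "u = l * (d + t)"
      using ut xL[OF u] xT[OF t] by (simp add: distrib_left)
    moreover obtain i where i: "i \<in> I" "u \<in> run l i" using u by blast
    ultimately have "d + t = i"
      using I multiple_mem_run[of i l "d + t"] by auto
    hence "d = i - t" by simp
    thus "d \<in> {u - s | u s. u \<in> I \<and> s \<in> T}" using i t by blast
  qed
  ultimately show ?thesis
    unfolding separated_differences_def by blast
qed

theorem theorem2p12:
  fixes l a b :: nat and V_small V_large W_small W_large :: "nat set"
  assumes "l \<ge> 2"
    and "alpha_valuation a b V_small V_large"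
    and "card V_small = a" and "card V_large = b"
    and "\<forall>y \<in> V_small. l dvd y"
    and "\<exists>I. I \<subseteq> {1..} \<and> V_large = (\<Union>i\<in>I. run l i)"
    and "W_small = {y div l | y. y \<in> V_small}"
    and "W_large = {i. i \<ge> 1 \<and> run l i \<subseteq> V_large}"
  shows "l dvd b \<and> alpha_valuation a (b div l) W_small W_large \<and>
         card W_small = a \<and> card W_large = b div l"
proof -
  have l: "l \<ge> 1" using assms(1) by simp
  obtain I where I: "I \<subseteq> {1..}" and VL: "V_large = (\<Union>i\<in>I. run l i)"
    using assms(6) by blast
  have WL: "W_large = I"
    unfolding assms(8) VL using run_subset_UN_iff[OF I l] I by auto
  have VS: "V_small = (*) l ` W_small"
    unfolding assms(7) using assms(5) by (auto simp: image_def)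
  have sep: "separated_differences (a * b) V_small V_large"
    by (rule separated_differences_if_alpha_valuation[OF assms(2-4)])
  have inj: "inj_on ((*) l) A" for A
    using l by (auto simp: inj_on_def)
  \<comment> \<open>\<open>I\<close> is not known to be finite yet. Multiplication by
    \<open>l\<close> embeds it into the bounded set \<open>V_large\<close>, and finiteness then
    permits counting \<open>V_large\<close> run by run.\<close>
  have "(*) l ` I \<subseteq> V_large"
    unfolding VL using last_mem_run[OF _ l] I by (force simp: mult.commute)
  moreover have "V_small \<union> V_large \<subseteq> {0..a * b}"
    using sep unfolding separated_differences_def by (rule conjunct1)
  ultimately have "(*) l ` W_small \<subseteq> {0..a * b}" "(*) l ` I \<subseteq> {0..a * b}"
    unfolding VS by auto
  hence fin: "finite W_small" "finite I"
    by (meson finite_atLeastAtMost finite_imageD finite_subset inj)+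
  have b: "b = l * card I"
    using card_UN_run[OF I fin(2)] assms(4) VL by simp
  have a: "card W_small = a"
    using assms(3) VS card_image[OF inj] by simp
  have bl: "b div l = card I" using b l by simp
  \<comment> \<open>By \<open>b = l * card I\<close>, the bound \<open>a * b\<close> is
    \<open>l\<close> times the number \<open>a * card I\<close> of edges of the smaller
    graph.\<close>
  have "separated_differences (l * (a * card I)) ((*) l ` W_small) (\<Union>i\<in>I. run l i)"
    using sep unfolding VS VL b by (simp add: mult.left_commute)
  hence "separated_differences (a * card I) W_small I"
    by (rule separated_differences_contract[OF l I])
  hence "alpha_valuation a (card I) W_small I"
    using fin a by (intro alpha_valuation_if_separated_differences) auto
  thus ?thesis using a b bl WL by simp
qed

end
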